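(* Let $S$ be a $\langle\vee,0\rangle$-semilattice, let $P$ be a poset, and let $\Vert{-}\leq{-}\Vert$ be an $S$-valued p-measure on $P$ satisfying the following condition: for all $x\leq y$ in $P$ and all $\boldsymbol{a},\boldsymbol{b}\in S$, if $\Vert y=x\Vert\leq\boldsymbol{a}\vee\boldsymbol{b}$, then there are a positive integer $n$ and a decomposition $x=z_0\leq z_1\leq\dots\leq z_n=y$ in $P$ such that either $\Vert z_{i+1}=z_i\Vert\leq\boldsymbol{a}$ or $\Vert z_{i+1}=z_i\Vert\leq\boldsymbol{b}$, for all $i<n$. Suppose that the subset $\Sigma=\{\Vert y=x\Vert\mid x\leq y\text{ in }P\}$ join-generates $S$. Then $S$ is distributive.
   Context: A $\langle\vee,0\rangle$-semilattice is a join-semilattice with least element $0$. A join-semilattice $S$ is distributive if for all $\boldsymbol{a},\boldsymbol{b},\boldsymbol{c}\in S$ with $\boldsymbol{c}\leq\boldsymbol{a}\vee\boldsymbol{b}$ there are $\boldsymbol{x}\leq\boldsymbol{a}$ and $\boldsymbol{y}\leq\boldsymbol{b}$ in $S$ such that $\boldsymbol{c}=\boldsymbol{x}\vee\boldsymbol{y}$. An $S$-valued p-measure on a poset $P$ is a map $P\times P\to S$, $(x,y)\mapsto\Vert x\leq y\Vert$, such that $\Vert x\leq z\Vert\leq\Vert x\leq y\Vert\vee\Vert y\leq z\Vert$ for all $x,y,z\in P$, and $x\leq y$ implies $\Vert x\leq y\Vert=0$. For comparable $x,y\in P$, $\Vert x=y\Vert$ denotes $\Vert\max\{x,y\}\leq\min\{x,y\}\Vert$.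 A subset $\Sigma$ join-generates $S$ if every element of $S$ is a join of finitely many elements of $\Sigma$. *)

theory Defs
  imports Main
begin

text \<open>
  A join-semilattice with least element is a type of class \<open>bounded_semilattice_sup_bot\<close>.
  A poset is a subset \<open>P\<close> of a type of class \<open>order\<close>, with the induced order; unlike a
  whole type, \<open>P\<close> may be empty. A p-measure on \<open>P\<close> is a function \<open>m\<close>, with \<open>m x y\<close> for the value
  of \<open>x \<le> y\<close>; its values outside \<open>P\<close> are irrelevant.
\<close>

definition p_measure ::
    "'p::order set \<Rightarrow> ('p \<Rightarrow> 'p \<Rightarrow> 's::bounded_semilattice_sup_bot) \<Rightarrow> bool" where
  "p_measure P m \<longleftrightarrow>
     (\<forall>x\<in>P. \<forall>y\<in>P. \<forall>z\<in>P. m x z \<le> sup (m x y) (m y z)) \<and>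
     (\<forall>x\<in>P. \<forall>y\<in>P. x \<le> y \<longrightarrow> m x y = bot)"

text \<open>
  The value of \<open>x = y\<close>. It is meaningful only for comparable \<open>x\<close> and \<open>y\<close>, for which
  \<^const>\<open>max\<close> and \<^const>\<open>min\<close> are the true maximum and minimum also in a partial order.
\<close>

definition p_eq :: "('p::order \<Rightarrow> 'p \<Rightarrow> 's) \<Rightarrow> 'p \<Rightarrow> 'p \<Rightarrow> 's" where
  "p_eq m x y = m (max x y) (min x y)"

text \<open>Inserting \<^const>\<open>bot\<close> makes the join of the empty set \<^const>\<open>bot\<close>, and changes no other join.\<close>

definition join_generates :: "'s::bounded_semilattice_sup_bot set \<Rightarrow> bool" where
  "join_generates \<Sigma> \<longleftrightarrow>
     (\<forall>s. \<exists>F. finite F \<and> F \<subseteq> \<Sigma> \<and> s = Sup_fin (insert bot F))"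

definition distributive_semilattice :: "'s::semilattice_sup itself \<Rightarrow> bool" where
  "distributive_semilattice _ \<longleftrightarrow>
     (\<forall>a b c :: 's. c \<le> sup a b \<longrightarrow> (\<exists>x y. x \<le> a \<and> y \<le> b \<and> c = sup x y))"

end

theory Submission imports Defs begin

text \<open>
  The elements \<open>c\<close> that split along a given pair \<open>a\<close>, \<open>b\<close>, that is, \<open>c = sup u v\<close> with \<open>u \<le> a\<close> and
  \<open>v \<le> b\<close>, are closed under finite joins: join the \<open>u\<close>-parts and the \<open>v\<close>-parts separately
  (\<open>splits_Sup_fin\<close>). If \<open>c\<close> is below \<open>sup a b\<close>, then so are all generators whose join is \<open>c\<close>,
  so only a generator \<open>m y x\<close> with \<open>x \<le> y\<close> has to be split. A chain from \<open>x\<close> to \<open>y\<close> with steps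
  measured by \<open>a\<close> or by \<open>b\<close> does this (\<open>chain_splits\<close>). Each step splits trivially, with \<open>bot\<close> as
  the other part. The triangle inequality bounds \<open>m y x\<close> by the join of the measures of the
  steps, and monotonicity (\<open>p_measure_mono\<close>) bounds each of these by \<open>m y x\<close>; so \<open>m y x\<close> is
  equal to that join, and it splits as well.
\<close>

definition splits :: "'s::semilattice_sup \<Rightarrow> 's \<Rightarrow> 's \<Rightarrow> bool" where
  "splits a b c \<longleftrightarrow> (\<exists>u v. u \<le> a \<and> v \<le> b \<and> c = sup u v)"

lemma splits_bot: "splits a b (bot :: 's::bounded_semilattice_sup_bot)"
  unfolding splits_def by (metis bot_least sup_bot_left)

lemma splits_sup:
  assumes "splits a b c" "splits a b d"
  shows "splits a b (sup c d)"
proof -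
  obtain u v where uv: "u \<le> a" "v \<le> b" "c = sup u v"
    using assms(1) unfolding splits_def by blast
  obtain u' v' where uv': "u' \<le> a" "v' \<le> b" "d = sup u' v'"
    using assms(2) unfolding splits_def by blast
  have "sup c d = sup (sup u u') (sup v v')"
    using uv(3) uv'(3) by (simp add: ac_simps)
  moreover have "sup u u' \<le> a" "sup v v' \<le> b"
    using uv uv' by simp_all
  ultimately show ?thesis
    unfolding splits_def by blast
qed

lemma splits_Sup_fin:
  assumes "finite F" "F \<noteq> {}" "\<And>s. s \<in> F \<Longrightarrow> splits a b s"
  shows "splits a b (Sup_fin F)"
  using assms by (induction F rule: finite_ne_induct) (auto intro: splits_sup)

lemma p_eq_of_le:
  fixes x y :: "'p::order"
  assumes "x \<le> y"
  shows "p_eq m y x = m y x"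
  using assms by (auto simp: p_eq_def max_def min_def)

text \<open>
  Two triangle inequalities, through \<open>p'\<close> and \<open>q'\<close>, in which the extra terms \<open>m p p'\<close> and
  \<open>m q' q\<close> vanish. For \<open>q \<le> p\<close> this says that the measure grows with the interval from \<open>q\<close> to \<open>p\<close>.
\<close>

lemma p_measure_mono:
  assumes m: "p_measure P m"
    and P: "p \<in> P" "p' \<in> P" "q \<in> P" "q' \<in> P"
    and le: "p \<le> p'" "q' \<le> q"
  shows "m p q \<le> m p' q'"
proof -
  have "m p q \<le> sup (m p p') (m p' q)" "m p' q \<le> sup (m p' q') (m q' q)"
    using m P unfolding p_measure_def by blast+
  moreover have "m p p' = bot" "m q' q = bot"
    using m P le unfolding p_measure_def by blast+
  ultimately show ?thesis by simp
qed

text \<open>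
  Splitting needs an equality, so the triangle inequality alone would not suffice to add a
  step to the chain; monotonicity gives the converse inequality.
\<close>

lemma chain_splits:
  fixes z :: "nat \<Rightarrow> 'p::order" and a b :: "'s::bounded_semilattice_sup_bot"
  assumes m: "p_measure P m"
    and zP: "\<And>i. i \<le> n \<Longrightarrow> z i \<in> P"
    and zle: "\<And>i. i < n \<Longrightarrow> z i \<le> z (Suc i)"
    and step: "\<And>i. i < n \<Longrightarrow> m (z (Suc i)) (z i) \<le> a \<or> m (z (Suc i)) (z i) \<le> b"
  shows "splits a b (m (z n) (z 0))"
proof -
  have mono: "z i \<le> z j" if "i \<le> j" "j \<le> n" for i j
    using that by (induction j rule: dec_induct) (auto intro: order_trans[OF _ zle])
  have "splits a b (m (z k) (z 0))" if "k \<le> n" for k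
    using that
  proof (induction k)
    case 0
    have "m (z 0) (z 0) = bot"
      using m zP[of 0] unfolding p_measure_def by blast
    then show ?case by (simp add: splits_bot)
  next
    case (Suc k)
    let ?s = "m (z (Suc k)) (z k)"
    have P: "z 0 \<in> P" "z k \<in> P" "z (Suc k) \<in> P"
      using zP Suc.prems by auto
    have le: "z 0 \<le> z k" "z k \<le> z (Suc k)"
      using mono Suc.prems by auto
    have "m (z (Suc k)) (z 0) = sup ?s (m (z k) (z 0))"
    proof (rule order.antisym)
      show "m (z (Suc k)) (z 0) \<le> sup ?s (m (z k) (z 0))"
        using m P unfolding p_measure_def by blast
      show "sup ?s (m (z k) (z 0)) \<le> m (z (Suc k)) (z 0)"
        using p_measure_mono[OF m] P le by simp
    qed
    moreover have "splits a b ?s"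
      using step[of k] Suc.prems unfolding splits_def
      by (metis Suc_le_lessD bot_least sup_bot_left sup_bot_right)
    ultimately show ?case
      using Suc splits_sup by simp
  qed
  then show ?thesis by simp
qed

theorem proposition10p5:
  fixes P :: "'p::order set"
    and m :: "'p \<Rightarrow> 'p \<Rightarrow> 's::bounded_semilattice_sup_bot"
  assumes "p_measure P m"
    and "\<And>x y a b. x \<in> P \<Longrightarrow> y \<in> P \<Longrightarrow> x \<le> y \<Longrightarrow> p_eq m y x \<le> sup a b \<Longrightarrow>
           \<exists>n z. 0 < (n::nat) \<and> z 0 = x \<and> z n = y \<and> (\<forall>i\<le>n. z i \<in> P) \<and>
             (\<forall>i<n. z i \<le> z (Suc i)) \<and>
             (\<forall>i<n. p_eq m (z (Suc i)) (z i) \<le> a \<or> p_eq m (z (Suc i)) (z i) \<le> b)"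
    and "join_generates {p_eq m y x | x y. x \<in> P \<and> y \<in> P \<and> x \<le> y}"
  shows "distributive_semilattice TYPE('s)"
proof -
  have generator: "splits a b (p_eq m y x)"
    if xy: "x \<in> P" "y \<in> P" "x \<le> y" and below: "p_eq m y x \<le> sup a b" for x y a b
  proof -
    obtain n z where z: "z 0 = x" "z (n::nat) = y" "\<forall>i\<le>n. z i \<in> P"
      "\<forall>i<n. z i \<le> z (Suc i)"
      "\<forall>i<n. p_eq m (z (Suc i)) (z i) \<le> a \<or> p_eq m (z (Suc i)) (z i) \<le> b"
      using assms(2)[OF xy below] by blast
    have "splits a b (m (z n) (z 0))"
      using z(3-5) by (intro chain_splits[OF assms(1)]) (auto simp: p_eq_of_le)
    then show ?thesis
      using z(1,2) xy(3) by (simp add: p_eq_of_le)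
  qed
  have "splits a b c" if c: "c \<le> sup a b" for a b c :: 's
  proof -
    obtain F where F: "finite F" "F \<subseteq> {p_eq m y x | x y. x \<in> P \<and> y \<in> P \<and> x \<le> y}"
      "c = Sup_fin (insert bot F)"
      using assms(3) unfolding join_generates_def by meson
    have "splits a b s" if "s \<in> insert bot F" for s
    proof (cases "s = bot")
      case True
      then show ?thesis by (simp add: splits_bot)
    next
      case False
      have "s \<le> c"
        using F(1,3) that by (simp add: Sup_fin.coboundedI)
      then have "s \<le> sup a b" using c by (rule order_trans)
      then show ?thesis using F(2) False that generator by blast
    qed
    then show ?thesis
      using F(1,3) splits_Sup_fin[of "insert bot F"] by simp
  qed
  then show ?thesis
    unfolding distributive_semilattice_def splits_def by blast
qed

end
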